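(* Let $d\in\mathbb{N}$, let $b<0$, and let $G:\mathbb{R}^d\to\mathbb{R}$, $G(u)=a^Tu-b$ with $a=(1,0,\dots,0)^T$. Let $U(t)$, $t\ge0$, be the large particle limit ($J\to\infty$) of the noise-free continuous-time EnKF for rare event estimation, with $U(0)$ a $d$-variate independent standard normal random variable (as defined in the context). Then the ensemble mean $m(t)=\mathbb{E}[U(t)]$ satisfies $$\lim_{t\to\infty}m(t)=(1-P_f)\,u^{\mathrm{MLFP}}+P_f\,u^{\mathrm{opt}}.$$
   Context: A state $u$ is safe if $G(u)\ge0$ and a failure state if $G(u)<0$ (the failure surface $\{G=0\}$, a null set, is counted as safe). The probability of failure is $P_f=\mathbb{P}(G(U(0))\le0)$ with $U(0)\sim\mathrm{N}(0,\mathrm{Id}_d)$, i.e. $P_f=\Phi(b)$, where $\Phi$ and $\varphi_1$ are the standard normal cdf and pdf. Most likely failure point: $u^{\mathrm{MLFP}}$ is the minimizer of $\frac12\Vert u\Vert_2^2$ subject to $G(u)=0$; here $u^{\mathrm{MLFP}}=(b,0,\dots,0)^T$. Mean of the optimal importance sampling density: $u^{\mathrm{opt}}=\mathbb{E}[U(0)\mid G(U(0))<0]=\left(-\frac{\varphi_1(b)}{\Phi(b)},0,\dots,0\right)^T$. Finite-ensemble dynamics: for an ensemble $\{u^{(j)}\}_{j=1}^J$ with empirical mean $\overline{u}$, empirical covariance $C_{\mathrm{uu}}(\mathbf{u})$ (normalized by $1/J$) and failure index set $F=\{k:G(u^{(k)})<0\}$, the noise-free continuous-time EnKF moves the safe particles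 by $$\frac{\mathrm{d}u^{(j)}}{\mathrm{d}t}=-C_{\mathrm{uu}}(\mathbf{u})D_u\left(\tfrac12G(u^{(j)})^2\right)+\frac{G(u^{(j)})}{J}\sum_{k\in F}G(u^{(k)})(u^{(k)}-\overline{u}),$$ and failure particles do not move. $D_u$ denotes the gradient, so $D_u(\frac12G(u)^2)=G(u)a$. Large particle limit $J\to\infty$: empirical averages are replaced by expectations. That is, $U(t)$, $t\ge0$, is an $\mathbb{R}^d$-valued random process with $U(0)\sim\mathrm{N}(0,\mathrm{Id}_d)$, $m(t)=\mathbb{E}[U(t)]$, $C(t)=\mathbb{E}[(U(t)-m(t))(U(t)-m(t))^T]$, such that each trajectory $u(t)$ of $U(t)$ satisfies, when $G(u(t))\ge0$, $$\frac{\mathrm{d}u(t)}{\mathrm{d}t}=-C(t)\,D_u\left(\tfrac12G(u(t))^2\right)+G(u(t))\,\mathbb{E}\left[I(G(U(t))<0)\,G(U(t))\,(U(t)-m(t))\right],$$ and $\frac{\mathrm{d}u(t)}{\mathrm{d}t}=0$ when $G(u(t))<0$, where $I$ is the indicator function. Safe particles remain safe and failure particles remain failure particles for all $t\ge0$. *)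

theory Defs
  imports "HOL-Probability.Probability"
begin

definition std_normal_vector :: "'w measure \<Rightarrow> ('w \<Rightarrow> real ^ 'n) \<Rightarrow> bool" where
  "std_normal_vector M X \<longleftrightarrow>
     prob_space.indep_vars M (\<lambda>_. borel) (\<lambda>i \<omega>. X \<omega> $ i) UNIV \<and>
     (\<forall>i. distributed M lborel (\<lambda>\<omega>. X \<omega> $ i) std_normal_density)"

definition mean_vec :: "'w measure \<Rightarrow> ('w \<Rightarrow> real ^ 'n) \<Rightarrow> real ^ 'n" where
  "mean_vec M X = (LINT \<omega>|M. X \<omega>)"

definition cov_mat :: "'w measure \<Rightarrow> ('w \<Rightarrow> real ^ 'n) \<Rightarrow> real ^ 'n ^ 'n" where
  "cov_mat M X = (\<chi> i j. LINT \<omega>|M. (X \<omega> - mean_vec M X) $ i * (X \<omega> - mean_vec M X) $ j)"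

definition gradient :: "(real ^ 'n \<Rightarrow> real) \<Rightarrow> real ^ 'n \<Rightarrow> real ^ 'n" where
  "gradient f x = (THE D. GDERIV f x :> D)"

text \<open>
  Limit, as the number of particles tends to infinity, of the term
  \<open>1/J \<Sum>\<^sub>k\<^sub>\<in>\<^sub>F G(u\<^sub>k)(u\<^sub>k - mean)\<close> in the finite-ensemble dynamics.
\<close>
definition failure_drift ::
  "'w measure \<Rightarrow> (real ^ 'n \<Rightarrow> real) \<Rightarrow> ('w \<Rightarrow> real ^ 'n) \<Rightarrow> real ^ 'n" where
  "failure_drift M G X =
     (LINT \<omega>|M. (indicator {u. G u < 0} (X \<omega>) * G (X \<omega>)) *\<^sub>R (X \<omega> - mean_vec M X))"

text \<open>
  Large particle limit of the noise-free continuous-time EnKF on a probability space \<open>M\<close>; only the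
  values \<open>U t\<close> with \<open>t \<ge> 0\<close> matter. The two integrability conditions make the expectations in the
  dynamics well defined, since the Bochner integral is \<open>0\<close> on non-integrable functions. At \<open>t = 0\<close>
  the time derivative is one-sided. Points with \<open>G u = 0\<close> count as safe.
\<close>
definition enkf_large_particle_limit ::
  "'w measure \<Rightarrow> (real ^ 'n \<Rightarrow> real) \<Rightarrow> (real \<Rightarrow> 'w \<Rightarrow> real ^ 'n) \<Rightarrow> bool" where
  "enkf_large_particle_limit M G U \<longleftrightarrow>
     prob_space M \<and>
     std_normal_vector M (U 0) \<and>
     (\<forall>t\<ge>0. U t \<in> borel_measurable M \<and>
        integrable M (\<lambda>\<omega>. (norm (U t \<omega>))\<^sup>2) \<and>
        integrable M (\<lambda>\<omega>. (indicator {u. G u < 0} (U t \<omega>) * G (U t \<omega>)) *\<^sub>R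
                           (U t \<omega> - mean_vec M (U t)))) \<and>
     (\<forall>\<omega>\<in>space M. \<forall>t\<ge>0.
        ((\<lambda>s. U s \<omega>) has_vector_derivative
           (if G (U t \<omega>) \<ge> 0
            then - (cov_mat M (U t) *v gradient (\<lambda>u. 1/2 * (G u)\<^sup>2) (U t \<omega>))
                 + G (U t \<omega>) *\<^sub>R failure_drift M G (U t)
            else 0)) (at t within {0..}))"

text \<open>The surface \<open>G = 0\<close> is included here, although its points count as safe; it is a null set under
  the standard normal law.\<close>
definition failure_prob :: "'w measure \<Rightarrow> (real ^ 'n \<Rightarrow> real) \<Rightarrow> ('w \<Rightarrow> real ^ 'n) \<Rightarrow> real" where
  "failure_prob M G X = measure M {\<omega> \<in> space M. G (X \<omega>) \<le> 0}"

definition most_likely_failure_point :: "(real ^ 'n \<Rightarrow> real) \<Rightarrow> real ^ 'n" where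
  "most_likely_failure_point G = (ARG_MIN (\<lambda>u. 1/2 * (norm u)\<^sup>2) u. G u = 0)"

text \<open>Conditional expectation of \<open>X\<close> given the event \<open>G X < 0\<close>, the mean of the optimal importance
  sampling density.\<close>
definition optimal_mean ::
  "'w measure \<Rightarrow> (real ^ 'n \<Rightarrow> real) \<Rightarrow> ('w \<Rightarrow> real ^ 'n) \<Rightarrow> real ^ 'n" where
  "optimal_mean M G X =
     (LINT \<omega>|uniform_measure M {\<omega> \<in> space M. G (X \<omega>) < 0}. X \<omega>)"

end

theory Submission
  imports Defs
begin

text \<open>
  Write \<open>g u = a \<bullet> u - b\<close> for the margin of a particle and \<open>g\<^sup>+\<close>, \<open>g\<^sup>-\<close> for the positive and negative
  parts of the initial margin.

  On safe particles the two terms of the dynamics combine: the covariance of the ensemble with \<open>g\<close>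
  minus its covariance with \<open>g\<close> restricted to the failure particles is the covariance with the
  positive part of \<open>g\<close>. So a safe particle moves by \<open>u' = g u \<cdot> v t\<close> with one velocity field
  \<open>v t = - E[max 0 (g (U t)) (U t - m t)]\<close> common to all of them (\<open>safe_drift_eq\<close>). Hence all safe
  particles move in the same direction, each at a rate proportional to its margin, and the
  infinite system collapses to a single displacement \<open>R\<close>:
  \<open>U t = U 0 + g\<^sup>+ R t\<close>, and all safe margins shrink by the common factor \<open>q t = 1 + a \<bullet> R t\<close>
  (\<open>particle_representation\<close>). Nothing is known beforehand about the regularity of \<open>v\<close> in time, so the
  comparison of particles rests on the sign \<open>a \<bullet> v t \<le> 0\<close>, which holds because a random variable and
  its positive part are nonnegatively correlated (\<open>safe_velocity_descends\<close>).

  Inserting the representation into the formula for \<open>v\<close> closes the equation: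
  \<open>R' = - q\<^sup>2 (E[g\<^sup>+ U 0] + Var(g\<^sup>+) R)\<close>. Independence and centredness of the components of the
  initial law give \<open>E[g\<^sup>+ U 0] = (Var(g\<^sup>+) + E[g\<^sup>+] E[g\<^sup>-]) a\<close>. Therefore \<open>R\<close> stays parallel to \<open>a\<close>, and
  \<open>q' = - q\<^sup>2 (Var(g\<^sup>+) q + E[g\<^sup>+] E[g\<^sup>-])\<close> forces \<open>q\<close> to \<open>0\<close>, because both safe and failure states have
  positive probability (\<open>displacement_limit\<close>). So \<open>R\<close> tends to \<open>- a\<close>: every safe particle approaches its
  orthogonal projection to the failure surface, and the mean \<open>E[g\<^sup>+] R t\<close> tends to \<open>- E[g\<^sup>+] a\<close>.

  The margin \<open>g\<^sup>+ - g\<^sup>-\<close> has mean \<open>- b\<close>, so with \<open>F\<close> the failure event and \<open>P\<close> its probability,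
  \<open>- E[g\<^sup>+] = b - E[g\<^sup>-] = b + E[1\<^sub>F (a \<bullet> U 0 - b)] = (1 - P) b + E[1\<^sub>F (a \<bullet> U 0)]\<close>. The first summand
  belongs to the most likely failure point \<open>b a\<close>. The second comes from the failure particles, which
  never moved; by independence \<open>E[1\<^sub>F U 0]\<close> is parallel to \<open>a\<close>, and it is \<open>P\<close> times the optimal mean.
\<close>

section \<open>Scalar differential equations on the half line\<close>

lemma antitone_within_nonneg_reals:
  fixes f f' :: "real \<Rightarrow> real"
  assumes "\<And>t. t \<ge> 0 \<Longrightarrow> (f has_real_derivative f' t) (at t within {0..})"
    and "\<And>t. t \<ge> 0 \<Longrightarrow> f' t \<le> 0"
    and "0 \<le> s" "s \<le> t"
  shows "f t \<le> f s"
proof (rule DERIV_nonpos_imp_decreasing_open[OF \<open>s \<le> t\<close>])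
  fix x assume "s < x" "x < t"
  with assms(3) have "x > 0" by simp
  then have "at x within {0..} = at x"
    by (intro at_within_interior) simp
  with assms(1,2)[of x] \<open>x > 0\<close> show "\<exists>y. DERIV f x :> y \<and> y \<le> 0" by auto
next
  have "continuous_on {0..} f"
    using assms(1) by (intro DERIV_continuous_on) auto
  then show "continuous_on {s..t} f"
    by (rule continuous_on_subset) (use assms in auto)
qed

text \<open>
  Uniqueness for a linear equation with an arbitrary nonpositive coefficient: the sign of \<open>c\<close>
  replaces the usual Gronwall bound, since it makes \<open>x\<^sup>2\<close> nonincreasing.
\<close>

lemma linear_ode_zero:
  fixes x c :: "real \<Rightarrow> real"
  assumes deriv: "\<And>t. t \<ge> 0 \<Longrightarrow> (x has_real_derivative c t * x t) (at t within {0..})"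
    and c: "\<And>t. t \<ge> 0 \<Longrightarrow> c t \<le> 0"
    and "x 0 = 0" "t \<ge> 0"
  shows "x t = 0"
proof -
  have "(x t)\<^sup>2 \<le> (x 0)\<^sup>2"
  proof (rule antitone_within_nonneg_reals[where f = "\<lambda>t. (x t)\<^sup>2" and f' = "\<lambda>t. 2 * c t * (x t)\<^sup>2"])
    fix t :: real assume "t \<ge> 0"
    show "((\<lambda>t. (x t)\<^sup>2) has_real_derivative 2 * c t * (x t)\<^sup>2) (at t within {0..})"
      using \<open>t \<ge> 0\<close> by (auto intro!: derivative_eq_intros deriv simp: power2_eq_square)
    show "2 * c t * (x t)\<^sup>2 \<le> 0"
      using c[OF \<open>t \<ge> 0\<close>] by (simp add: mult_nonpos_nonneg)
  qed (use assms in auto)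
  then show ?thesis using \<open>x 0 = 0\<close> by simp
qed

text \<open>
  Squaring smooths the kink of the negative part at \<open>0\<close>, so that the negative part of a
  differentiable function can be studied by differentiation.
\<close>

lemma has_real_derivative_square_negative_part:
  fixes x :: real
  shows "((\<lambda>x. (min x 0)\<^sup>2) has_real_derivative 2 * min x 0) (at x)"
proof -
  consider "x < 0" | "x = 0" | "x > 0" by linarith
  then show ?thesis
  proof cases
    case 1
    have "((\<lambda>x. x\<^sup>2) has_real_derivative 2 * x) (at x)"
      by (auto intro!: derivative_eq_intros)
    moreover have "eventually (\<lambda>y. y < 0) (nhds x)"
      using 1 by (intro eventually_nhds_in_open[of "{..<0}", simplified]) auto
    then have "eventually (\<lambda>y. (min y 0)\<^sup>2 = y\<^sup>2) (nhds x)"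
      by eventually_elim simp
    ultimately show ?thesis using 1 by (simp add: DERIV_cong_ev[OF refl _ refl])
  next
    case 2
    have "(\<lambda>h. (min h 0)\<^sup>2 / h) \<midarrow>0\<rightarrow> (0::real)"
    proof (rule Lim_null_comparison[where g = "\<lambda>h. \<bar>h\<bar>"])
      show "\<forall>\<^sub>F h in at 0. norm ((min h 0)\<^sup>2 / h) \<le> \<bar>h\<bar>" for h :: real
        by (rule always_eventually) (auto simp: min_def power2_eq_square)
    qed (auto intro!: tendsto_eq_intros)
    then show ?thesis using 2 by (simp add: DERIV_def)
  next
    case 3
    have "eventually (\<lambda>y. y > 0) (nhds x)"
      using 3 by (intro eventually_nhds_in_open[of "{0<..}", simplified]) auto
    then have "eventually (\<lambda>y. (min y 0)\<^sup>2 = 0) (nhds x)"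
      by eventually_elim simp
    then have "((\<lambda>x. (min x 0)\<^sup>2) has_real_derivative 0) (at x)"
      by (subst DERIV_cong_ev[OF refl, where g = "\<lambda>_. 0"]) auto
    then show ?thesis using 3 by simp
  qed
qed

text \<open>
  This is why particles can cross the failure surface in neither direction: the square of the
  negative part of the margin has derivative \<open>0\<close> both where the margin is negative (it is at rest)
  and where it is not (the negative part vanishes).
\<close>

lemma negative_part_conserved:
  fixes g g' :: "real \<Rightarrow> real"
  assumes deriv: "\<And>t. t \<ge> 0 \<Longrightarrow> (g has_real_derivative g' t) (at t within {0..})"
    and rest: "\<And>t. t \<ge> 0 \<Longrightarrow> g t < 0 \<Longrightarrow> g' t = 0"
    and "t \<ge> 0"
  shows "min (g t) 0 = min (g 0) 0"
proof -
  have "\<exists>c. \<forall>t\<in>{0..}. (min (g t) 0)\<^sup>2 = c"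
  proof (rule has_field_derivative_zero_constant)
    fix t :: real assume "t \<in> {0..}"
    then have "t \<ge> 0" by simp
    have "((\<lambda>t. (min (g t) 0)\<^sup>2) has_real_derivative 2 * min (g t) 0 * g' t) (at t within {0..})"
      by (rule DERIV_chain2[OF has_real_derivative_square_negative_part deriv[OF \<open>t \<ge> 0\<close>]])
    also have "2 * min (g t) 0 * g' t = 0"
      using rest[OF \<open>t \<ge> 0\<close>] by (cases "g t < 0") auto
    finally show "((\<lambda>t. (min (g t) 0)\<^sup>2) has_real_derivative 0) (at t within {0..})" .
  qed simp
  then have "(min (g t) 0)\<^sup>2 = (min (g 0) 0)\<^sup>2" using \<open>t \<ge> 0\<close> by auto
  then show ?thesis by (auto simp: power2_eq_iff min_def split: if_splits)
qed

text \<open>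
  As long as \<open>q \<ge> e\<close>, the function decreases at least at the speed \<open>B e\<^sup>2\<close>, so it is below \<open>e\<close> after the time
  \<open>q 0 / (B e\<^sup>2)\<close>.
\<close>

lemma tendsto_zero_if_quadratic_decay:
  fixes q q' :: "real \<Rightarrow> real"
  assumes deriv: "\<And>t. t \<ge> 0 \<Longrightarrow> (q has_real_derivative q' t) (at t within {0..})"
    and decay: "\<And>t. t \<ge> 0 \<Longrightarrow> q' t \<le> - B * (q t)\<^sup>2"
    and "B > 0" and nonneg: "\<And>t. t \<ge> 0 \<Longrightarrow> q t \<ge> 0"
  shows "(q \<longlongrightarrow> 0) at_top"
proof (rule order_tendstoI)
  fix e :: real assume "e < 0"
  then show "\<forall>\<^sub>F t in at_top. e < q t"
    by (intro eventually_at_top_linorderI[of 0]) (use nonneg in force)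
next
  fix e :: real assume "e > 0"
  have anti: "q t \<le> q s" if "0 \<le> s" "s \<le> t" for s t
  proof (rule antitone_within_nonneg_reals[OF deriv _ that])
    show "q' t \<le> 0" if "t \<ge> 0" for t
      using decay[OF that] \<open>B > 0\<close> by (smt (verit) mult_nonneg_nonneg zero_le_power2 mult_minus_left)
  qed
  have small: "q t < e" if "t > q 0 / (B * e\<^sup>2)" "t \<ge> 0" for t
  proof (rule ccontr)
    assume "\<not> q t < e"
    have "q t + B * e\<^sup>2 * t \<le> q 0 + B * e\<^sup>2 * 0"
    proof (rule DERIV_nonpos_imp_decreasing_open[OF \<open>t \<ge> 0\<close>])
      fix x assume x: "0 < x" "x < t"
      then have "at x within {0..} = at x" by (intro at_within_interior) simp
      with deriv[of x] x have "DERIV q x :> q' x" by simp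
      then have "DERIV (\<lambda>t. q t + B * e\<^sup>2 * t) x :> q' x + B * e\<^sup>2"
        by (auto intro!: derivative_eq_intros)
      moreover have "e\<^sup>2 \<le> (q x)\<^sup>2"
        using anti[of x t] x \<open>\<not> q t < e\<close> \<open>e > 0\<close> by (intro power_mono) auto
      then have "B * e\<^sup>2 \<le> B * (q x)\<^sup>2" using \<open>B > 0\<close> by simp
      then have "q' x + B * e\<^sup>2 \<le> 0" using decay[of x] x by simp
      ultimately show "\<exists>y. DERIV (\<lambda>t. q t + B * e\<^sup>2 * t) x :> y \<and> y \<le> 0" by blast
    next
      have "continuous_on {0..} q" using deriv by (intro DERIV_continuous_on) auto
      then have "continuous_on {0..t} q" by (rule continuous_on_subset) auto
      then show "continuous_on {0..t} (\<lambda>t. q t + B * e\<^sup>2 * t)"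
        by (intro continuous_intros)
    qed
    moreover have "B * e\<^sup>2 * t > q 0"
      using that \<open>B > 0\<close> \<open>e > 0\<close> by (simp add: field_simps)
    ultimately show False using nonneg[OF \<open>t \<ge> 0\<close>] by simp
  qed
  show "\<forall>\<^sub>F t in at_top. q t < e"
    using eventually_gt_at_top[of "q 0 / (B * e\<^sup>2)"] eventually_ge_at_top[of 0]
    by eventually_elim (rule small)
qed

section \<open>Collapse of the dynamics to one displacement and its limit\<close>

text \<open>
  Two safe margins solve the same scalar linear equation, so they remain proportional by
  \<open>linear_ode_zero\<close>; the displacements of two safe particles then have proportional
  derivatives. One safe reference particle \<open>\<omega>\<^sub>0\<close> thus determines the motion of all others, and its
  displacement per unit of initial margin is \<open>R\<close>.
\<close>

lemma particle_representation:
  fixes U :: "real \<Rightarrow> 'w \<Rightarrow> 'v::real_inner" and v :: "real \<Rightarrow> 'v"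
  assumes deriv: "\<And>\<omega> t. \<omega> \<in> \<Omega> \<Longrightarrow> t \<ge> 0 \<Longrightarrow>
      ((\<lambda>s. U s \<omega>) has_vector_derivative
        (if a \<bullet> U t \<omega> - b \<ge> 0 then (a \<bullet> U t \<omega> - b) *\<^sub>R v t else 0)) (at t within {0..})"
    and v: "\<And>t. t \<ge> 0 \<Longrightarrow> a \<bullet> v t \<le> 0"
    and ref: "\<omega>\<^sub>0 \<in> \<Omega>" "a \<bullet> U 0 \<omega>\<^sub>0 - b > 0"
  obtains R where "R 0 = 0"
    and "\<And>t. t \<ge> 0 \<Longrightarrow> (R has_vector_derivative (1 + a \<bullet> R t) *\<^sub>R v t) (at t within {0..})"
    and "\<And>t. t \<ge> 0 \<Longrightarrow> 1 + a \<bullet> R t \<ge> 0"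
    and "\<And>\<omega> t. \<omega> \<in> \<Omega> \<Longrightarrow> t \<ge> 0 \<Longrightarrow> U t \<omega> = U 0 \<omega> + max 0 (a \<bullet> U 0 \<omega> - b) *\<^sub>R R t"
    and "\<And>\<omega> t. \<omega> \<in> \<Omega> \<Longrightarrow> t \<ge> 0 \<Longrightarrow>
      max 0 (a \<bullet> U t \<omega> - b) = (1 + a \<bullet> R t) * max 0 (a \<bullet> U 0 \<omega> - b)"
proof -
  define g where "g t \<omega> = a \<bullet> U t \<omega> - b" for t \<omega>
  have dU: "((\<lambda>s. U s \<omega>) has_vector_derivative max 0 (g t \<omega>) *\<^sub>R v t) (at t within {0..})"
    if "\<omega> \<in> \<Omega>" "t \<ge> 0" for \<omega> t
  proof -
    have "(if g t \<omega> \<ge> 0 then g t \<omega> *\<^sub>R v t else 0) = max 0 (g t \<omega>) *\<^sub>R v t"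
      by (simp add: max_def)
    with deriv[OF that, folded g_def] show ?thesis by simp
  qed
  have dg: "((\<lambda>s. g s \<omega>) has_real_derivative max 0 (g t \<omega>) * (a \<bullet> v t)) (at t within {0..})"
    if "\<omega> \<in> \<Omega>" "t \<ge> 0" for \<omega> t
  proof -
    have "((\<lambda>s. a \<bullet> U s \<omega>) has_vector_derivative a \<bullet> (max 0 (g t \<omega>) *\<^sub>R v t)) (at t within {0..})"
      by (rule bounded_linear.has_vector_derivative[OF bounded_linear_inner_right dU[OF that]])
    then show ?thesis
      unfolding g_def has_real_derivative_iff_has_vector_derivative
      by (auto intro!: derivative_eq_intros)
  qed
  have neg_part: "min (g t \<omega>) 0 = min (g 0 \<omega>) 0" if "\<omega> \<in> \<Omega>" "t \<ge> 0" for \<omega> t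
    by (rule negative_part_conserved[OF dg[OF that(1)] _ that(2)]) (auto simp: max_def)
  have pos: "g t \<omega> \<ge> 0" if "\<omega> \<in> \<Omega>" "g 0 \<omega> \<ge> 0" "t \<ge> 0" for \<omega> t
    using neg_part[of \<omega> t] that by (auto simp: min_def split: if_splits)
  have fail: "g t \<omega> = g 0 \<omega>" if "\<omega> \<in> \<Omega>" "g 0 \<omega> < 0" "t \<ge> 0" for \<omega> t
    using neg_part[of \<omega> t] that by (auto simp: min_def split: if_splits)
  define \<gamma> where "\<gamma> = g 0 \<omega>\<^sub>0"
  have "\<gamma> > 0" using ref by (simp add: \<gamma>_def g_def)
  define q where "q t = g t \<omega>\<^sub>0 / \<gamma>" for t
  define R where "R t = (1 / \<gamma>) *\<^sub>R (U t \<omega>\<^sub>0 - U 0 \<omega>\<^sub>0)" for t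
  have qR: "q t = 1 + a \<bullet> R t" for t
  proof -
    have "1 + a \<bullet> R t = (\<gamma> + (a \<bullet> U t \<omega>\<^sub>0 - a \<bullet> U 0 \<omega>\<^sub>0)) / \<gamma>"
      using \<open>\<gamma> > 0\<close> by (simp add: R_def inner_diff_right field_simps)
    then show ?thesis by (simp add: q_def g_def \<gamma>_def)
  qed
  have q_nonneg: "q t \<ge> 0" if "t \<ge> 0" for t
    using pos[of \<omega>\<^sub>0 t] ref that \<open>\<gamma> > 0\<close> by (simp add: q_def \<gamma>_def)
  have dR: "(R has_vector_derivative q t *\<^sub>R v t) (at t within {0..})" if "t \<ge> 0" for t
  proof -
    have "max 0 (g t \<omega>\<^sub>0) = \<gamma> * q t"
      using q_nonneg[OF that] \<open>\<gamma> > 0\<close> by (simp add: q_def max_def zero_le_divide_iff)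
    with dU[OF ref(1) that]
    have "((\<lambda>t. U t \<omega>\<^sub>0 - U 0 \<omega>\<^sub>0) has_vector_derivative (\<gamma> * q t) *\<^sub>R v t) (at t within {0..})"
      by (auto intro!: derivative_eq_intros)
    from bounded_linear.has_vector_derivative[OF bounded_linear_scaleR_right[of "1/\<gamma>"] this]
    show ?thesis using \<open>\<gamma> > 0\<close> by (simp add: R_def[abs_def])
  qed
  have gq: "max 0 (g t \<omega>) = q t * max 0 (g 0 \<omega>)" if "\<omega> \<in> \<Omega>" "t \<ge> 0" for \<omega> t
  proof (cases "g 0 \<omega> < 0")
    case True
    then show ?thesis using fail[OF that(1) True that(2)] by simp
  next
    case False
    \<comment> \<open>This cross-multiplied difference solves the same linear equation as the margins and starts at
      \<open>0\<close>; taking the quotient instead would require the reference margin to stay positive.\<close>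
    have "g t \<omega> * \<gamma> - g 0 \<omega> * g t \<omega>\<^sub>0 = 0"
    proof (rule linear_ode_zero[where c = "\<lambda>t. a \<bullet> v t" and x = "\<lambda>t. g t \<omega> * \<gamma> - g 0 \<omega> * g t \<omega>\<^sub>0"])
      fix s :: real assume s: "s \<ge> 0"
      show "((\<lambda>t. g t \<omega> * \<gamma> - g 0 \<omega> * g t \<omega>\<^sub>0) has_real_derivative
          a \<bullet> v s * (g s \<omega> * \<gamma> - g 0 \<omega> * g s \<omega>\<^sub>0)) (at s within {0..})"
        using pos[OF that(1) _ s] pos[OF ref(1) _ s] False \<open>\<gamma> > 0\<close>
        by (auto intro!: derivative_eq_intros dg s that ref simp: max_def \<gamma>_def algebra_simps)
    qed (use v that in \<open>auto simp: \<gamma>_def\<close>)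
    then have "g t \<omega> = q t * g 0 \<omega>" using \<open>\<gamma> > 0\<close> by (simp add: q_def field_simps)
    then show ?thesis using False pos[OF that(1) _ that(2)] by (simp add: max_def)
  qed
  have rep: "U t \<omega> = U 0 \<omega> + max 0 (g 0 \<omega>) *\<^sub>R R t" if "\<omega> \<in> \<Omega>" "t \<ge> 0" for \<omega> t
  proof -
    have "\<exists>c. \<forall>t\<in>{0..}. U t \<omega> - max 0 (g 0 \<omega>) *\<^sub>R R t = c"
    proof (rule has_derivative_zero_constant)
      fix s :: real assume "s \<in> {0..}"
      then have s: "s \<ge> 0" by simp
      have "((\<lambda>t. U t \<omega> - max 0 (g 0 \<omega>) *\<^sub>R R t) has_vector_derivative
          max 0 (g s \<omega>) *\<^sub>R v s - max 0 (g 0 \<omega>) *\<^sub>R (q s *\<^sub>R v s)) (at s within {0..})"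
        by (intro has_vector_derivative_diff dU that s
            bounded_linear.has_vector_derivative[OF bounded_linear_scaleR_right] dR)
      also have "max 0 (g s \<omega>) *\<^sub>R v s - max 0 (g 0 \<omega>) *\<^sub>R (q s *\<^sub>R v s) = 0"
        using gq[OF that(1) s] by (simp add: mult.commute)
      finally show "((\<lambda>t. U t \<omega> - max 0 (g 0 \<omega>) *\<^sub>R R t) has_derivative (\<lambda>h. 0)) (at s within {0..})"
        by (simp add: has_vector_derivative_def)
    qed simp
    then have "U t \<omega> - max 0 (g 0 \<omega>) *\<^sub>R R t = U 0 \<omega> - max 0 (g 0 \<omega>) *\<^sub>R R 0"
      using that(2) by auto
    then show ?thesis by (simp add: R_def algebra_simps)
  qed
  show ?thesis
  proof (rule that[of R])
    show "R 0 = 0" by (simp add: R_def)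
  qed (fact dR[unfolded qR] q_nonneg[unfolded qR] rep[unfolded g_def] gq[unfolded g_def qR])+
qed

text \<open>
  The components of \<open>R\<close> orthogonal to \<open>a\<close> solve a homogeneous linear equation and vanish; the
  component along \<open>a\<close> satisfies \<open>q' = - q\<^sup>2 (A q + B)\<close> for \<open>q = 1 + a \<bullet> R\<close>, which drives \<open>q\<close> to \<open>0\<close>.
\<close>

lemma displacement_limit:
  fixes R :: "real \<Rightarrow> 'v::real_inner"
  assumes deriv: "\<And>t. t \<ge> 0 \<Longrightarrow> (R has_vector_derivative
        - (1 + a \<bullet> R t)\<^sup>2 *\<^sub>R ((A + B) *\<^sub>R a + A *\<^sub>R R t)) (at t within {0..})"
    and q: "\<And>t. t \<ge> 0 \<Longrightarrow> 1 + a \<bullet> R t \<ge> 0"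
    and "R 0 = 0" "norm a = 1" "A \<ge> 0" "B > 0"
  shows "(R \<longlongrightarrow> - a) at_top"
proof -
  define q where "q t = 1 + a \<bullet> R t" for t
  have aa: "a \<bullet> a = 1" using \<open>norm a = 1\<close> by (simp add: norm_eq_1)
  have dot: "((\<lambda>t. c \<bullet> R t) has_real_derivative
      - (q t)\<^sup>2 * ((A + B) * (c \<bullet> a) + A * (c \<bullet> R t))) (at t within {0..})" if "t \<ge> 0" for c t
    using bounded_linear.has_vector_derivative[OF bounded_linear_inner_right deriv[OF that], of c]
    by (simp add: has_real_derivative_iff_has_vector_derivative q_def inner_add_right)
  have along: "R t = (q t - 1) *\<^sub>R a" if "t \<ge> 0" for t
  proof -
    \<comment> \<open>The orthogonal part of \<open>R\<close> at the fixed time \<open>t\<close> serves as a constant test direction: if the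
      component of \<open>R\<close> in this direction vanishes at all times, it does so at \<open>t\<close>, where it equals
      \<open>c \<bullet> c\<close>.\<close>
    define c where "c = R t - (a \<bullet> R t) *\<^sub>R a"
    have ca: "c \<bullet> a = 0" by (simp add: c_def inner_diff_left aa inner_commute[of "R t" a])
    have "c \<bullet> R t = 0"
    proof (rule linear_ode_zero[where x = "\<lambda>t. c \<bullet> R t" and c = "\<lambda>t. - (q t)\<^sup>2 * A"])
      show "((\<lambda>t. c \<bullet> R t) has_real_derivative - (q s)\<^sup>2 * A * (c \<bullet> R s)) (at s within {0..})"
        if "s \<ge> 0" for s
        using dot[OF that, of c] by (simp add: ca mult.assoc)
    qed (use \<open>A \<ge> 0\<close> \<open>R 0 = 0\<close> that in auto)
    moreover have "c \<bullet> c = c \<bullet> R t - (a \<bullet> R t) * (c \<bullet> a)"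
      by (subst (2) c_def) (simp only: inner_diff_right inner_scaleR_right)
    ultimately have "c \<bullet> c = 0" using ca by simp
    then show ?thesis by (simp add: c_def q_def)
  qed
  have "(q \<longlongrightarrow> 0) at_top"
  proof (rule tendsto_zero_if_quadratic_decay[OF _ _ \<open>B > 0\<close>])
    fix t :: real assume t: "t \<ge> 0"
    show "(q has_real_derivative - (q t)\<^sup>2 * (A * q t + B)) (at t within {0..})"
      using dot[OF t, of a] unfolding q_def[abs_def]
      by (auto intro!: derivative_eq_intros simp: aa algebra_simps)
    show "q t \<ge> 0" using q[OF t] by (simp add: q_def)
    then have "0 \<le> (q t)\<^sup>2 * (A * q t)" using \<open>A \<ge> 0\<close> by simp
    then show "- (q t)\<^sup>2 * (A * q t + B) \<le> - B * (q t)\<^sup>2" by (simp add: algebra_simps)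
  qed
  then have "((\<lambda>t. (q t - 1) *\<^sub>R a) \<longlongrightarrow> (0 - 1) *\<^sub>R a) at_top"
    by (intro tendsto_intros)
  then have "((\<lambda>t. (q t - 1) *\<^sub>R a) \<longlongrightarrow> - a) at_top" by simp
  then show ?thesis
    by (rule Lim_transform_eventually)
       (use along in \<open>auto intro: eventually_at_top_linorderI[of 0]\<close>)
qed

section \<open>Square-integrable random vectors\<close>

lemma integrable_scaleR_square_integrable:
  fixes f :: "'w \<Rightarrow> real" and X :: "'w \<Rightarrow> 'v::{banach, second_countable_topology}"
  assumes [measurable]: "f \<in> borel_measurable M" "X \<in> borel_measurable M"
    and "integrable M (\<lambda>\<omega>. (f \<omega>)\<^sup>2)" "integrable M (\<lambda>\<omega>. (norm (X \<omega>))\<^sup>2)"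
  shows "integrable M (\<lambda>\<omega>. f \<omega> *\<^sub>R X \<omega>)"
proof (rule Bochner_Integration.integrable_bound)
  show "integrable M (\<lambda>\<omega>. (f \<omega>)\<^sup>2 + (norm (X \<omega>))\<^sup>2)" using assms by simp
  have "\<bar>x\<bar> * y \<le> x\<^sup>2 + y\<^sup>2" if "y \<ge> 0" for x y :: real
  proof -
    have "2 * (\<bar>x\<bar> * y) \<le> x\<^sup>2 + y\<^sup>2" using sum_squares_bound[of "\<bar>x\<bar>" y] by simp
    moreover have "0 \<le> \<bar>x\<bar> * y" using that by simp
    ultimately show ?thesis by linarith
  qed
  then show "AE \<omega> in M. norm (f \<omega> *\<^sub>R X \<omega>) \<le> norm ((f \<omega>)\<^sup>2 + (norm (X \<omega>))\<^sup>2)"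
    by simp
qed simp

lemma square_integrable_vector_imp_integrable:
  fixes X :: "'w \<Rightarrow> 'v::{banach, second_countable_topology}"
  assumes "finite_measure M" and [measurable]: "X \<in> borel_measurable M"
    and "integrable M (\<lambda>\<omega>. (norm (X \<omega>))\<^sup>2)"
  shows "integrable M X"
  using integrable_scaleR_square_integrable[of "\<lambda>_. 1" M X] assms
  by (simp add: finite_measure.integrable_const)

lemma square_integrable_diff_const:
  fixes X :: "'w \<Rightarrow> 'v::euclidean_space"
  assumes "finite_measure M" and [measurable]: "X \<in> borel_measurable M"
    and "integrable M (\<lambda>\<omega>. (norm (X \<omega>))\<^sup>2)"
  shows "integrable M (\<lambda>\<omega>. (norm (X \<omega> - c))\<^sup>2)"
proof -
  interpret finite_measure M by fact
  have "integrable M X" by (rule square_integrable_vector_imp_integrable) fact+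
  have "integrable M (\<lambda>\<omega>. (norm (X \<omega>))\<^sup>2 - 2 * (X \<omega> \<bullet> c) + c \<bullet> c)"
    using assms \<open>integrable M X\<close> by simp
  then show ?thesis
    by (simp add: power2_norm_eq_inner inner_diff_left inner_diff_right inner_commute algebra_simps)
qed

lemma square_integrable_inner:
  fixes X :: "'w \<Rightarrow> 'v::euclidean_space"
  assumes [measurable]: "X \<in> borel_measurable M"
    and "integrable M (\<lambda>\<omega>. (norm (X \<omega>))\<^sup>2)"
  shows "integrable M (\<lambda>\<omega>. (a \<bullet> X \<omega>)\<^sup>2)"
proof (rule Bochner_Integration.integrable_bound)
  show "integrable M (\<lambda>\<omega>. (norm a)\<^sup>2 * (norm (X \<omega>))\<^sup>2)" using assms by simp
  show "AE \<omega> in M. norm ((a \<bullet> X \<omega>)\<^sup>2) \<le> norm ((norm a)\<^sup>2 * (norm (X \<omega>))\<^sup>2)"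
    using Cauchy_Schwarz_ineq[of a] by (simp add: power2_norm_eq_inner)
qed simp

lemma square_integrable_positive_part:
  fixes Y :: "'w \<Rightarrow> real"
  assumes [measurable]: "Y \<in> borel_measurable M" and "integrable M (\<lambda>\<omega>. (Y \<omega>)\<^sup>2)"
  shows "integrable M (\<lambda>\<omega>. (max 0 (Y \<omega>))\<^sup>2)"
  by (rule Bochner_Integration.integrable_bound[OF assms(2)]) (auto simp: max_def)

text \<open>
  A nondecreasing function of \<open>Y\<close> is nonnegatively correlated with \<open>Y\<close>: with \<open>m\<close> the mean of \<open>Y\<close>, the
  product \<open>(max 0 Y - max 0 m) (Y - m)\<close> is nonnegative everywhere, and the constant \<open>max 0 m\<close>
  does not contribute to the expectation because \<open>Y - m\<close> is centred.
\<close>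

lemma covariance_positive_part_nonneg:
  fixes Y :: "'w \<Rightarrow> real"
  assumes "prob_space M" and [measurable]: "Y \<in> borel_measurable M"
    and sq: "integrable M (\<lambda>\<omega>. (Y \<omega>)\<^sup>2)"
  shows "0 \<le> (LINT \<omega>|M. max 0 (Y \<omega>) * (Y \<omega> - (LINT \<omega>|M. Y \<omega>)))"
proof -
  interpret prob_space M by fact
  define m where "m = (LINT \<omega>|M. Y \<omega>)"
  have Y: "integrable M Y" by (rule square_integrable_imp_integrable) (use sq in auto)
  have sq': "integrable M (\<lambda>\<omega>. (norm (Y \<omega> - m))\<^sup>2)"
    by (rule square_integrable_diff_const) (use sq finite_measure_axioms in auto)
  have YY: "integrable M (\<lambda>\<omega>. max 0 (Y \<omega>) * (Y \<omega> - m))"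
    using integrable_scaleR_square_integrable[OF _ _ square_integrable_positive_part[OF _ sq] sq']
    by simp
  have "0 \<le> (LINT \<omega>|M. (max 0 (Y \<omega>) - max 0 m) * (Y \<omega> - m))"
  proof (rule Bochner_Integration.integral_nonneg)
    show "0 \<le> (max 0 y - max 0 m) * (y - m)" for y
      by (auto simp: max_def zero_le_mult_iff mult_nonneg_nonpos)
  qed
  also have "\<dots> = (LINT \<omega>|M. max 0 (Y \<omega>) * (Y \<omega> - m)) - max 0 m * (LINT \<omega>|M. Y \<omega> - m)"
    using YY Y by (simp add: left_diff_distrib)
  also have "(LINT \<omega>|M. Y \<omega> - m) = 0" using Y by (simp add: m_def prob_space)
  finally show ?thesis by (simp add: m_def)
qed

section \<open>The common velocity field of the safe particles\<close>

lemma gradient_half_square_affine: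
  fixes a :: "real ^ 'n"
  shows "gradient (\<lambda>u. 1/2 * (a \<bullet> u - b)\<^sup>2) x = (a \<bullet> x - b) *\<^sub>R a"
proof -
  have "GDERIV (\<lambda>u. 1/2 * (a \<bullet> u - b)\<^sup>2) x :> (a \<bullet> x - b) *\<^sub>R a"
    unfolding gderiv_def by (auto intro!: derivative_eq_intros simp: inner_commute)
  moreover have "D = D'" if "GDERIV f x :> D" "GDERIV f x :> D'"
    for f and D D' :: "real ^ 'n"
  proof -
    have "(\<lambda>h. h \<bullet> D) = (\<lambda>h. h \<bullet> D')"
      using that unfolding gderiv_def by (rule has_derivative_unique)
    then have "(D - D') \<bullet> D = (D - D') \<bullet> D'" by metis
    then have "(D - D') \<bullet> (D - D') = 0" by (simp add: inner_diff_right)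
    then show ?thesis by simp
  qed
  ultimately show ?thesis unfolding gradient_def by (blast intro: the_equality)
qed

text \<open>
  The velocity of a safe particle per unit of its margin \<open>G\<close>. It is minus the
  covariance of the positive part of \<open>G (X)\<close> with \<open>X\<close>.
\<close>

definition safe_velocity ::
  "'w measure \<Rightarrow> (real ^ 'n \<Rightarrow> real) \<Rightarrow> ('w \<Rightarrow> real ^ 'n) \<Rightarrow> real ^ 'n" where
  "safe_velocity M G X = - (LINT \<omega>|M. max 0 (G (X \<omega>)) *\<^sub>R (X \<omega> - mean_vec M X))"

lemma cov_mat_mult_vector:
  fixes X :: "'w \<Rightarrow> real ^ 'n"
  assumes [measurable]: "X \<in> borel_measurable M" and "prob_space M"
    and sq: "integrable M (\<lambda>\<omega>. (norm (X \<omega>))\<^sup>2)"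
  shows "cov_mat M X *v a =
    (LINT \<omega>|M. (a \<bullet> (X \<omega> - mean_vec M X)) *\<^sub>R (X \<omega> - mean_vec M X))" (is "_ = integral\<^sup>L M ?f")
proof (subst vec_eq_iff, rule allI)
  fix i
  interpret prob_space M by fact
  define Y where "Y \<omega> = X \<omega> - mean_vec M X" for \<omega>
  have [measurable]: "Y \<in> borel_measurable M" by (simp add: Y_def[abs_def])
  have sqY: "integrable M (\<lambda>\<omega>. (norm (Y \<omega>))\<^sup>2)"
    unfolding Y_def by (rule square_integrable_diff_const) (use sq finite_measure_axioms in auto)
  have int: "integrable M (\<lambda>\<omega>. (c \<bullet> Y \<omega>) *\<^sub>R Y \<omega>)" for c
    by (rule integrable_scaleR_square_integrable) (use square_integrable_inner[OF _ sqY] sqY in auto)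
  have prod: "integrable M (\<lambda>\<omega>. Y \<omega> $ i * Y \<omega> $ j)" for j
    using integrable_bounded_linear[OF bounded_linear_vec_nth int[of "axis i 1"], of j]
    by (simp add: inner_axis')
  have "(cov_mat M X *v a) $ i = (\<Sum>j\<in>UNIV. (LINT \<omega>|M. Y \<omega> $ i * Y \<omega> $ j) * a $ j)"
    by (simp add: cov_mat_def matrix_vector_mult_def Y_def)
  also have "\<dots> = (LINT \<omega>|M. (\<Sum>j\<in>UNIV. Y \<omega> $ i * Y \<omega> $ j * a $ j))"
    using prod by simp
  also have "\<dots> = (LINT \<omega>|M. ((a \<bullet> Y \<omega>) *\<^sub>R Y \<omega>) $ i)"
    by (simp add: inner_vec_def sum_distrib_right sum_distrib_left mult_ac)
  also have "\<dots> = integral\<^sup>L M (\<lambda>\<omega>. (a \<bullet> Y \<omega>) *\<^sub>R Y \<omega>) $ i"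
    by (rule integral_bounded_linear[OF bounded_linear_vec_nth int])
  finally show "(cov_mat M X *v a) $ i = integral\<^sup>L M ?f $ i" by (simp add: Y_def)
qed

text \<open>
  Both drift terms are the margin of the particle times an expectation. With \<open>Y = X - mean\<close>, the
  identity \<open>1\<^sub>F G(X) - a \<bullet> Y = c - max 0 (G(X))\<close> with a constant \<open>c\<close> merges them, and \<open>c\<close> drops
  out because \<open>Y\<close> is centred.
\<close>

lemma safe_drift_eq:
  fixes X :: "'w \<Rightarrow> real ^ 'n"
  assumes "prob_space M" and [measurable]: "X \<in> borel_measurable M"
    and sq: "integrable M (\<lambda>\<omega>. (norm (X \<omega>))\<^sup>2)"
    and G: "G = (\<lambda>u. a \<bullet> u - b)"
    and fd: "integrable M (\<lambda>\<omega>. (indicator {u. G u < 0} (X \<omega>) * G (X \<omega>)) *\<^sub>R (X \<omega> - mean_vec M X))"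
  shows "- (cov_mat M X *v gradient (\<lambda>u. 1/2 * (G u)\<^sup>2) x) + G x *\<^sub>R failure_drift M G X
    = G x *\<^sub>R safe_velocity M G X"
proof -
  interpret prob_space M by fact
  define Y where "Y \<omega> = X \<omega> - mean_vec M X" for \<omega>
  have [measurable]: "Y \<in> borel_measurable M" by (simp add: Y_def[abs_def])
  have X: "integrable M X"
    by (rule square_integrable_vector_imp_integrable) (use sq finite_measure_axioms in auto)
  have sqY: "integrable M (\<lambda>\<omega>. (norm (Y \<omega>))\<^sup>2)"
    unfolding Y_def by (rule square_integrable_diff_const) (use sq finite_measure_axioms in auto)
  have Y: "integrable M Y" using X by (simp add: Y_def[abs_def])
  have EY: "(LINT \<omega>|M. Y \<omega>) = 0" using X by (simp add: Y_def mean_vec_def prob_space)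
  have int: "integrable M (\<lambda>\<omega>. (a \<bullet> Y \<omega>) *\<^sub>R Y \<omega>)"
    by (rule integrable_scaleR_square_integrable) (use square_integrable_inner[OF _ sqY] sqY in auto)
  have fd': "integrable M (\<lambda>\<omega>. (indicator {u. G u < 0} (X \<omega>) * G (X \<omega>)) *\<^sub>R Y \<omega>)"
    using fd by (simp add: Y_def)
  define c where "c = a \<bullet> mean_vec M X - b"
  have split: "max 0 (G (X \<omega>)) *\<^sub>R Y \<omega> = (a \<bullet> Y \<omega>) *\<^sub>R Y \<omega> + c *\<^sub>R Y \<omega>
      - (indicator {u. G u < 0} (X \<omega>) * G (X \<omega>)) *\<^sub>R Y \<omega>" for \<omega>
  proof -
    have "max 0 (G (X \<omega>)) = a \<bullet> Y \<omega> + c - indicator {u. G u < 0} (X \<omega>) * G (X \<omega>)"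
      by (simp add: G Y_def c_def inner_diff_right max_def indicator_def)
    then show ?thesis by (simp add: scaleR_add_left scaleR_diff_left)
  qed
  have "(LINT \<omega>|M. max 0 (G (X \<omega>)) *\<^sub>R Y \<omega>) =
      (LINT \<omega>|M. (a \<bullet> Y \<omega>) *\<^sub>R Y \<omega>) + c *\<^sub>R (LINT \<omega>|M. Y \<omega>)
      - (LINT \<omega>|M. (indicator {u. G u < 0} (X \<omega>) * G (X \<omega>)) *\<^sub>R Y \<omega>)"
    unfolding split using int Y fd' by simp
  then have "safe_velocity M G X = failure_drift M G X - cov_mat M X *v a"
    using cov_mat_mult_vector[OF _ \<open>prob_space M\<close> sq, of a]
    by (simp add: safe_velocity_def failure_drift_def EY[unfolded Y_def] Y_def)
  moreover have "gradient (\<lambda>u. 1/2 * (G u)\<^sup>2) x = G x *\<^sub>R a"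
    unfolding G by (rule gradient_half_square_affine)
  ultimately show ?thesis
    by (simp add: matrix_vector_mult_scaleR scaleR_diff_right)
qed

lemma safe_velocity_descends:
  fixes X :: "'w \<Rightarrow> real ^ 'n"
  assumes "prob_space M" and [measurable]: "X \<in> borel_measurable M"
    and sq: "integrable M (\<lambda>\<omega>. (norm (X \<omega>))\<^sup>2)"
  shows "a \<bullet> safe_velocity M (\<lambda>u. a \<bullet> u - b) X \<le> 0"
proof -
  interpret prob_space M by fact
  define Y where "Y \<omega> = a \<bullet> X \<omega> - b" for \<omega>
  have [measurable]: "Y \<in> borel_measurable M" by (simp add: Y_def[abs_def])
  have X: "integrable M X"
    by (rule square_integrable_vector_imp_integrable) (use sq finite_measure_axioms in auto)
  have sqY: "integrable M (\<lambda>\<omega>. (Y \<omega>)\<^sup>2)"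
    using square_integrable_diff_const[of M "\<lambda>\<omega>. a \<bullet> X \<omega>" b] square_integrable_inner[of X M a] sq
      finite_measure_axioms by (simp add: Y_def)
  have sqX: "integrable M (\<lambda>\<omega>. (norm (X \<omega> - mean_vec M X))\<^sup>2)"
    by (rule square_integrable_diff_const) (use sq finite_measure_axioms in auto)
  have int: "integrable M (\<lambda>\<omega>. max 0 (Y \<omega>) *\<^sub>R (X \<omega> - mean_vec M X))"
    by (rule integrable_scaleR_square_integrable)
       (use square_integrable_positive_part[OF _ sqY] sqX in auto)
  have EY: "(LINT \<omega>|M. Y \<omega>) = a \<bullet> mean_vec M X - b"
    using X by (simp add: Y_def mean_vec_def prob_space)
  have "a \<bullet> (LINT \<omega>|M. max 0 (Y \<omega>) *\<^sub>R (X \<omega> - mean_vec M X))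
      = (LINT \<omega>|M. a \<bullet> (max 0 (Y \<omega>) *\<^sub>R (X \<omega> - mean_vec M X)))"
    by (rule integral_bounded_linear[OF bounded_linear_inner_right int, symmetric])
  also have "\<dots> = (LINT \<omega>|M. max 0 (Y \<omega>) * (Y \<omega> - (LINT \<omega>|M. Y \<omega>)))"
    unfolding EY by (simp add: Y_def inner_diff_right)
  also have "\<dots> \<ge> 0" by (rule covariance_positive_part_nonneg) (use sqY \<open>prob_space M\<close> in auto)
  finally show ?thesis by (simp add: safe_velocity_def Y_def)
qed

text \<open>
  This closes the mean-field equation: for an ensemble displaced from \<open>X\<close> in proportion to \<open>f\<close>, the
  velocity field depends on the displacement \<open>r\<close> and the shrinking factor \<open>q\<close> only, with coefficients
  that are moments of the initial ensemble.
\<close>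

lemma safe_velocity_transported:
  fixes X V :: "'w \<Rightarrow> real ^ 'n" and f :: "'w \<Rightarrow> real"
  assumes "prob_space M" and X: "integrable M X" "mean_vec M X = 0"
    and f: "integrable M f" "integrable M (\<lambda>\<omega>. (f \<omega>)\<^sup>2)"
    and fX: "integrable M (\<lambda>\<omega>. f \<omega> *\<^sub>R X \<omega>)"
    and V: "\<And>\<omega>. \<omega> \<in> space M \<Longrightarrow> V \<omega> = X \<omega> + f \<omega> *\<^sub>R r"
    and GV: "\<And>\<omega>. \<omega> \<in> space M \<Longrightarrow> max 0 (G (V \<omega>)) = q * f \<omega>"
  shows "mean_vec M V = (LINT \<omega>|M. f \<omega>) *\<^sub>R r"
    and "safe_velocity M G V =
      - q *\<^sub>R ((LINT \<omega>|M. f \<omega> *\<^sub>R X \<omega>) + prob_space.variance M f *\<^sub>R r)"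
proof -
  interpret prob_space M by fact
  have "mean_vec M V = (LINT \<omega>|M. X \<omega> + f \<omega> *\<^sub>R r)"
    unfolding mean_vec_def by (rule Bochner_Integration.integral_cong) (use V in auto)
  also have "\<dots> = (LINT \<omega>|M. f \<omega>) *\<^sub>R r"
    using X f by (simp add: mean_vec_def)
  finally show mean: "mean_vec M V = (LINT \<omega>|M. f \<omega>) *\<^sub>R r" .
  define c where "c = (LINT \<omega>|M. f \<omega>)"
  have "(LINT \<omega>|M. max 0 (G (V \<omega>)) *\<^sub>R (V \<omega> - mean_vec M V))
      = (LINT \<omega>|M. q *\<^sub>R (f \<omega> *\<^sub>R X \<omega> + ((f \<omega>)\<^sup>2 - c * f \<omega>) *\<^sub>R r))"
  proof (rule Bochner_Integration.integral_cong)
    fix \<omega> assume \<omega>: "\<omega> \<in> space M"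
    show "max 0 (G (V \<omega>)) *\<^sub>R (V \<omega> - mean_vec M V)
        = q *\<^sub>R (f \<omega> *\<^sub>R X \<omega> + ((f \<omega>)\<^sup>2 - c * f \<omega>) *\<^sub>R r)"
      unfolding mean GV[OF \<omega>] c_def[symmetric]
      by (simp add: V[OF \<omega>] algebra_simps power2_eq_square)
  qed simp
  also have "\<dots> = q *\<^sub>R ((LINT \<omega>|M. f \<omega> *\<^sub>R X \<omega>) + (LINT \<omega>|M. (f \<omega>)\<^sup>2 - c * f \<omega>) *\<^sub>R r)"
    using fX f by simp
  also have "(LINT \<omega>|M. (f \<omega>)\<^sup>2 - c * f \<omega>) = variance f"
    using f by (subst variance_eq) (simp_all add: c_def power2_eq_square)
  finally show "safe_velocity M G V = - q *\<^sub>R ((LINT \<omega>|M. f \<omega> *\<^sub>R X \<omega>) + variance f *\<^sub>R r)"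
    by (simp add: safe_velocity_def)
qed

section \<open>The initial normal law\<close>

lemma std_normal_vector_component:
  fixes X :: "'w \<Rightarrow> real ^ 'n"
  assumes "std_normal_vector M X"
  shows "distributed M lborel (\<lambda>\<omega>. X \<omega> $ i) std_normal_density"
  using assms by (simp add: std_normal_vector_def)

lemma mean_vec_std_normal:
  fixes X :: "'w \<Rightarrow> real ^ 'n"
  assumes "prob_space M" "std_normal_vector M X" and X: "integrable M X"
  shows "mean_vec M X = 0"
proof (subst vec_eq_iff, rule allI)
  fix i
  have "mean_vec M X $ i = (LINT \<omega>|M. X \<omega> $ i)"
    unfolding mean_vec_def by (rule integral_bounded_linear[OF bounded_linear_vec_nth X, symmetric])
  also have "\<dots> = 0"
    by (rule prob_space.standard_normal_distributed_expectation
        [OF \<open>prob_space M\<close> std_normal_vector_component[OF assms(2)]])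
  finally show "mean_vec M X $ i = 0 $ i" by simp
qed

text \<open>
  The components of \<open>X\<close> other than the \<open>i\<close>-th are independent of the weight and have mean \<open>0\<close>. This is
  used twice: for the weight \<open>g\<^sup>+\<close> in the limiting dynamics and for the indicator of failure in the
  optimal mean.
\<close>

lemma expectation_weighted_std_normal:
  fixes X :: "'w \<Rightarrow> real ^ 'n" and h :: "real \<Rightarrow> real"
  assumes "prob_space M" "std_normal_vector M X" and X: "integrable M X"
    and h[measurable]: "h \<in> borel_measurable borel"
    and hX: "integrable M (\<lambda>\<omega>. h (X \<omega> $ i))"
    and int: "integrable M (\<lambda>\<omega>. h (X \<omega> $ i) *\<^sub>R X \<omega>)"
  shows "(LINT \<omega>|M. h (X \<omega> $ i) *\<^sub>R X \<omega>) = (LINT \<omega>|M. h (X \<omega> $ i) * X \<omega> $ i) *\<^sub>R axis i 1"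
proof (subst vec_eq_iff, rule allI)
  fix j
  interpret prob_space M by fact
  have comp: "(LINT \<omega>|M. h (X \<omega> $ i) *\<^sub>R X \<omega>) $ j = (LINT \<omega>|M. h (X \<omega> $ i) * X \<omega> $ j)"
    using integral_bounded_linear[OF bounded_linear_vec_nth int, of j] by simp
  show "(LINT \<omega>|M. h (X \<omega> $ i) *\<^sub>R X \<omega>) $ j
      = ((LINT \<omega>|M. h (X \<omega> $ i) * X \<omega> $ i) *\<^sub>R axis i 1) $ j"
  proof (cases "j = i")
    case True
    then show ?thesis using comp by simp
  next
    case False
    define Y where "Y k = (if k = i then h else (\<lambda>x. x))" for k
    have "indep_vars (\<lambda>_. borel) (\<lambda>k \<omega>. X \<omega> $ k) {i, j}"
      using assms(2) by (simp add: std_normal_vector_def indep_vars_subset[OF _ subset_UNIV])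
    then have indep: "indep_vars (\<lambda>_. borel) (\<lambda>k \<omega>. Y k (X \<omega> $ k)) {i, j}"
      by (rule indep_vars_compose2) (simp add: Y_def)
    have Xj: "integrable M (\<lambda>\<omega>. X \<omega> $ j)"
      by (rule integrable_bounded_linear[OF bounded_linear_vec_nth X])
    have "(LINT \<omega>|M. (\<Prod>k\<in>{i, j}. Y k (X \<omega> $ k))) = (\<Prod>k\<in>{i, j}. (LINT \<omega>|M. Y k (X \<omega> $ k)))"
      by (rule indep_vars_lebesgue_integral) (use indep hX Xj in \<open>auto simp: Y_def\<close>)
    then have "(LINT \<omega>|M. h (X \<omega> $ i) * X \<omega> $ j) = (LINT \<omega>|M. h (X \<omega> $ i)) * (LINT \<omega>|M. X \<omega> $ j)"
      using False by (simp add: Y_def)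
    also have "(LINT \<omega>|M. X \<omega> $ j) = 0"
      by (rule standard_normal_distributed_expectation[OF std_normal_vector_component[OF assms(2)]])
    finally show ?thesis using False by (simp add: comp axis_def)
  qed
qed

lemma prob_std_normal_le_eq_less:
  fixes Z :: "'w \<Rightarrow> real"
  assumes "prob_space M" and D: "distributed M lborel Z std_normal_density"
  shows "measure M {\<omega> \<in> space M. Z \<omega> \<le> b} = measure M {\<omega> \<in> space M. Z \<omega> < b}"
    and "measure M {\<omega> \<in> space M. Z \<omega> < b} > 0"
proof -
  interpret prob_space M by fact
  have [measurable]: "Z \<in> borel_measurable M"
    using distributed_measurable[OF D] by simp
  have "emeasure M (Z -` {b} \<inter> space M) =
      (\<integral>\<^sup>+x. ennreal (std_normal_density x) * indicator {b} x \<partial>lborel)"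
    by (rule distributed_emeasure[OF D]) simp
  also have "\<dots> = 0"
    by (rule nn_integral_null_set) (simp add: null_sets_def)
  finally have null: "Z -` {b} \<inter> space M \<in> null_sets M" by auto
  have "{\<omega> \<in> space M. Z \<omega> \<le> b} = {\<omega> \<in> space M. Z \<omega> < b} \<union> (Z -` {b} \<inter> space M)" by auto
  then show "measure M {\<omega> \<in> space M. Z \<omega> \<le> b} = measure M {\<omega> \<in> space M. Z \<omega> < b}"
    using null by (simp add: measure_Un_null_set)
  have eq: "{\<omega> \<in> space M. Z \<omega> < b} = Z -` {..<b} \<inter> space M" by auto
  have "emeasure M (Z -` {..<b} \<inter> space M) \<noteq> 0"
  proof
    assume "emeasure M (Z -` {..<b} \<inter> space M) = 0"
    then have "(\<integral>\<^sup>+x. ennreal (std_normal_density x) * indicator {..<b} x \<partial>lborel) = 0"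
      using distributed_emeasure[OF D, of "{..<b}"] by simp
    then have "AE x in lborel. ennreal (std_normal_density x) * indicator {..<b} x = 0"
      by (subst (asm) nn_integral_0_iff_AE) auto
    then have "AE x in lborel. x \<notin> {b - 1<..<b}"
    proof eventually_elim
      case (elim x)
      moreover have "ennreal (std_normal_density x) \<noteq> 0"
        using normal_density_pos[of 1 0 x] by simp
      ultimately show ?case by (auto simp: indicator_def split: if_splits)
    qed
    then have "{b - 1<..<b} \<in> null_sets lborel" by (subst AE_iff_null_sets) auto
    then show False by (simp add: null_sets_def)
  qed
  then show "measure M {\<omega> \<in> space M. Z \<omega> < b} > 0"
    unfolding eq by (simp add: emeasure_eq_measure zero_less_measure_iff)
qed

text \<open>
  The covariance of the positive part with \<open>Y\<close> exceeds its variance by minus its covariance with the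
  negative part. As the product of the two parts vanishes, this excess is the product of their
  means. It supplies the decay constant \<open>B\<close> of \<open>displacement_limit\<close>.
\<close>

lemma positive_part_moments:
  fixes Y :: "'w \<Rightarrow> real"
  assumes "prob_space M" and [measurable]: "Y \<in> borel_measurable M"
    and sq: "integrable M (\<lambda>\<omega>. (Y \<omega>)\<^sup>2)"
  defines "f \<equiv> \<lambda>\<omega>. max 0 (Y \<omega>)"
  shows "(LINT \<omega>|M. f \<omega> * (Y \<omega> - (LINT \<omega>|M. Y \<omega>)))
    = prob_space.variance M f + (LINT \<omega>|M. f \<omega>) * (LINT \<omega>|M. max 0 (- Y \<omega>))"
proof -
  interpret prob_space M by fact
  have Y: "integrable M Y" by (rule square_integrable_imp_integrable) (use sq in auto)
  have fsq: "integrable M (\<lambda>\<omega>. (f \<omega>)\<^sup>2)"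
    unfolding f_def by (rule square_integrable_positive_part) (use sq in auto)
  have f: "integrable M f" using Y by (simp add: f_def)
  have "(LINT \<omega>|M. Y \<omega>) = (LINT \<omega>|M. f \<omega> - max 0 (- Y \<omega>))"
    by (rule Bochner_Integration.integral_cong) (auto simp: f_def max_def)
  also have "\<dots> = (LINT \<omega>|M. f \<omega>) - (LINT \<omega>|M. max 0 (- Y \<omega>))"
    using f Y by simp
  finally have EY: "(LINT \<omega>|M. Y \<omega>) = (LINT \<omega>|M. f \<omega>) - (LINT \<omega>|M. max 0 (- Y \<omega>))" .
  have "(LINT \<omega>|M. f \<omega> * (Y \<omega> - (LINT \<omega>|M. Y \<omega>))) =
      (LINT \<omega>|M. (f \<omega>)\<^sup>2 - (LINT \<omega>|M. Y \<omega>) * f \<omega>)"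
    by (rule Bochner_Integration.integral_cong) (auto simp: f_def max_def algebra_simps power2_eq_square)
  also have "\<dots> = (LINT \<omega>|M. (f \<omega>)\<^sup>2) - (LINT \<omega>|M. Y \<omega>) * (LINT \<omega>|M. f \<omega>)"
    using f fsq by simp
  also have "\<dots> = variance f + (LINT \<omega>|M. f \<omega>) * (LINT \<omega>|M. max 0 (- Y \<omega>))"
    unfolding variance_eq[OF f fsq] EY by (simp add: algebra_simps power2_eq_square)
  finally show ?thesis .
qed

section \<open>Limit of the ensemble mean\<close>

lemma most_likely_failure_point_affine:
  fixes a :: "real ^ 'n"
  assumes "norm a = 1"
  shows "most_likely_failure_point (\<lambda>u. a \<bullet> u - b) = b *\<^sub>R a"
proof -
  have aa: "a \<bullet> a = 1" using assms by (simp add: norm_eq_1)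
  have expand: "(norm y)\<^sup>2 = b\<^sup>2 + (norm (y - b *\<^sub>R a))\<^sup>2" if "a \<bullet> y - b = 0" for y :: "real ^ 'n"
    using that aa unfolding power2_norm_eq_inner
    by (simp add: inner_diff_left inner_diff_right inner_commute[of y a] power2_eq_square)
  have ba: "(norm (b *\<^sub>R a))\<^sup>2 = b\<^sup>2" using assms by (simp add: power_mult_distrib)
  show ?thesis unfolding most_likely_failure_point_def
  proof (rule arg_minI[where x = "b *\<^sub>R a"])
    show "a \<bullet> b *\<^sub>R a - b = 0" by (simp add: aa)
    show "\<not> 1/2 * (norm y)\<^sup>2 < 1/2 * (norm (b *\<^sub>R a))\<^sup>2" if "a \<bullet> y - b = 0" for y
      using expand[OF that] unfolding ba by simp
    fix y assume y: "a \<bullet> y - b = 0"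
      and "\<forall>z. a \<bullet> z - b = 0 \<longrightarrow> \<not> 1/2 * (norm z)\<^sup>2 < 1/2 * (norm y)\<^sup>2"
    from this(2)[rule_format, of "b *\<^sub>R a"]
    have "(norm y)\<^sup>2 \<le> (norm (b *\<^sub>R a))\<^sup>2" by (simp add: aa not_less del: norm_scaleR)
    then have "(norm (y - b *\<^sub>R a))\<^sup>2 \<le> 0" using expand[OF y] ba by simp
    then show "y = b *\<^sub>R a" by simp
  qed
qed

lemma uniform_measure_integral:
  fixes f :: "'w \<Rightarrow> 'v::{banach, second_countable_topology}"
  assumes "finite_measure M" and [measurable]: "A \<in> sets M" "f \<in> borel_measurable M"
    and "measure M A > 0"
  shows "(LINT \<omega>|uniform_measure M A. f \<omega>) = (1 / measure M A) *\<^sub>R (LINT \<omega>|M. indicator A \<omega> *\<^sub>R f \<omega>)"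
proof -
  interpret finite_measure M by fact
  have "uniform_measure M A = density M (\<lambda>\<omega>. ennreal (indicator A \<omega> / measure M A))"
    unfolding uniform_measure_def using assms(4)
    by (intro density_cong)
       (auto simp: emeasure_eq_measure indicator_def divide_ennreal ennreal_1[symmetric] simp del: ennreal_1)
  then have "(LINT \<omega>|uniform_measure M A. f \<omega>) = (LINT \<omega>|M. (indicator A \<omega> / measure M A) *\<^sub>R f \<omega>)"
    by (simp add: integral_density)
  also have "\<dots> = (LINT \<omega>|M. (1 / measure M A) *\<^sub>R (indicator A \<omega> *\<^sub>R f \<omega>))" by simp
  also have "\<dots> = (1 / measure M A) *\<^sub>R (LINT \<omega>|M. indicator A \<omega> *\<^sub>R f \<omega>)"
    by (rule integral_scaleR_right)
  finally show ?thesis .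
qed

theorem theorem4p7:
  fixes M :: "'w measure"
    and U :: "real \<Rightarrow> 'w \<Rightarrow> real ^ 'n"
    and G :: "real ^ 'n \<Rightarrow> real"
    and a :: "real ^ 'n"
    and b :: real
    and first :: 'n
  assumes "b < 0"
    and "a = axis first 1"
    and "G = (\<lambda>u. a \<bullet> u - b)"
    and "enkf_large_particle_limit M G U"
  shows "((\<lambda>t. mean_vec M (U t)) \<longlongrightarrow>
           (1 - failure_prob M G (U 0)) *\<^sub>R most_likely_failure_point G
           + failure_prob M G (U 0) *\<^sub>R optimal_mean M G (U 0)) at_top"
proof -
  have M: "prob_space M" and normal: "std_normal_vector M (U 0)"
    and meas[measurable]: "\<And>t. t \<ge> 0 \<Longrightarrow> U t \<in> borel_measurable M"
    and sq: "\<And>t. t \<ge> 0 \<Longrightarrow> integrable M (\<lambda>\<omega>. (norm (U t \<omega>))\<^sup>2)"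
    and fd: "\<And>t. t \<ge> 0 \<Longrightarrow> integrable M
          (\<lambda>\<omega>. (indicator {u. G u < 0} (U t \<omega>) * G (U t \<omega>)) *\<^sub>R (U t \<omega> - mean_vec M (U t)))"
    and ode: "\<And>\<omega> t. \<omega> \<in> space M \<Longrightarrow> t \<ge> 0 \<Longrightarrow>
        ((\<lambda>s. U s \<omega>) has_vector_derivative
           (if G (U t \<omega>) \<ge> 0
            then - (cov_mat M (U t) *v gradient (\<lambda>u. 1/2 * (G u)\<^sup>2) (U t \<omega>))
                 + G (U t \<omega>) *\<^sub>R failure_drift M G (U t)
            else 0)) (at t within {0..})"
    using assms(4) unfolding enkf_large_particle_limit_def by auto
  interpret prob_space M by (rule M)
  have norm_a: "norm a = 1" using assms(2) by simp
  have coord: "a \<bullet> x = x $ first" for x by (simp add: assms(2) inner_axis')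

  \<comment> \<open>Moments of the initial ensemble: \<open>Y\<close> is the initial margin, \<open>f\<close> its positive part.\<close>
  define X where "X = U 0"
  have [measurable]: "X \<in> borel_measurable M" by (simp add: X_def meas)
  have sqX: "integrable M (\<lambda>\<omega>. (norm (X \<omega>))\<^sup>2)" using sq[of 0] by (simp add: X_def)
  have intX: "integrable M X"
    by (rule square_integrable_vector_imp_integrable) (use sqX finite_measure_axioms in auto)
  have nX: "std_normal_vector M X" using normal by (simp add: X_def)
  have meanX: "mean_vec M X = 0" by (rule mean_vec_std_normal[OF M nX intX])
  define Y where "Y \<omega> = a \<bullet> X \<omega> - b" for \<omega>
  have [measurable]: "Y \<in> borel_measurable M" by (simp add: Y_def[abs_def])
  have sqY: "integrable M (\<lambda>\<omega>. (Y \<omega>)\<^sup>2)"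
    using square_integrable_diff_const[of M "\<lambda>\<omega>. a \<bullet> X \<omega>" b] square_integrable_inner[of X M a] sqX
      finite_measure_axioms by (simp add: Y_def)
  have intY: "integrable M Y" by (rule square_integrable_imp_integrable) (use sqY in auto)
  have EY: "expectation Y = - b"
    using intX meanX by (simp add: Y_def[abs_def] mean_vec_def prob_space)
  define f where "f \<omega> = max 0 (Y \<omega>)" for \<omega>
  have [measurable]: "f \<in> borel_measurable M" by (simp add: f_def[abs_def])
  have f_int: "integrable M f" using intY by (simp add: f_def[abs_def])
  have f_sq: "integrable M (\<lambda>\<omega>. (f \<omega>)\<^sup>2)"
    unfolding f_def by (rule square_integrable_positive_part) (use sqY in auto)
  have fX: "integrable M (\<lambda>\<omega>. f \<omega> *\<^sub>R X \<omega>)"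
    by (rule integrable_scaleR_square_integrable) (use f_sq sqX in auto)
  \<comment> \<open>The mean margin \<open>- b\<close> is positive, so safe particles carry mass.\<close>
  have "expectation Y \<le> expectation f"
    by (rule integral_mono) (use intY f_int in \<open>auto simp: f_def\<close>)
  then have Ef: "expectation f > 0" using EY \<open>b < 0\<close> by simp
  define F where "F = {\<omega> \<in> space M. Y \<omega> < 0}"
  have [measurable]: "F \<in> sets M" by (simp add: F_def)
  have F_eq: "F = {\<omega> \<in> space M. X \<omega> $ first < b}" by (simp add: F_def Y_def coord)
  note D = std_normal_vector_component[OF nX, of first]
  have PF: "measure M F > 0"
    unfolding F_eq by (rule prob_std_normal_le_eq_less(2)[OF M D])
  have Pf: "failure_prob M G X = measure M F"
    unfolding F_eq failure_prob_def using prob_std_normal_le_eq_less(1)[OF M D, of b]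
    by (simp add: assms(3) coord)
  define B where "B = expectation f * expectation (\<lambda>\<omega>. max 0 (- Y \<omega>))"
  have "expectation (\<lambda>\<omega>. max 0 (- Y \<omega>)) \<noteq> 0"
  proof
    assume "expectation (\<lambda>\<omega>. max 0 (- Y \<omega>)) = 0"
    then have "AE \<omega> in M. max 0 (- Y \<omega>) = 0"
      using intY by (subst (asm) integral_nonneg_eq_0_iff_AE) auto
    then have "AE \<omega> in M. \<omega> \<notin> F" by eventually_elim (auto simp: F_def max_def split: if_splits)
    then have "prob F = 0" by (subst (asm) prob_eq_0[symmetric]) auto
    with PF show False by simp
  qed
  moreover have "expectation (\<lambda>\<omega>. max 0 (- Y \<omega>)) \<ge> 0"
    by (rule Bochner_Integration.integral_nonneg) simp
  ultimately have "B > 0" unfolding B_def using Ef by (intro mult_pos_pos) linarith+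
  have f_coord: "f = (\<lambda>\<omega>. max 0 (X \<omega> $ first - b))"
    by (simp add: f_def[abs_def] Y_def coord)
  have fX_axis: "expectation (\<lambda>\<omega>. f \<omega> *\<^sub>R X \<omega>) = (variance f + B) *\<^sub>R a"
  proof -
    have "expectation (\<lambda>\<omega>. f \<omega> *\<^sub>R X \<omega>) = expectation (\<lambda>\<omega>. f \<omega> * X \<omega> $ first) *\<^sub>R a"
      using expectation_weighted_std_normal[OF M nX intX, of "\<lambda>x. max 0 (x - b)" first] f_int fX
      unfolding f_coord assms(2) by simp
    also have "expectation (\<lambda>\<omega>. f \<omega> * X \<omega> $ first) = expectation (\<lambda>\<omega>. f \<omega> * (Y \<omega> - expectation Y))"
      unfolding EY by (simp add: Y_def coord)
    also have "\<dots> = variance f + B"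
      unfolding B_def f_def by (rule positive_part_moments[OF M _ sqY]) simp
    finally show ?thesis .
  qed

  \<comment> \<open>A safe particle that can serve as the reference for the motion of all others.\<close>
  have "\<exists>\<omega>\<in>space M. Y \<omega> > 0"
  proof (rule ccontr)
    assume "\<not> (\<exists>\<omega>\<in>space M. Y \<omega> > 0)"
    then have "f \<omega> = 0" if "\<omega> \<in> space M" for \<omega>
      using that by (force simp: f_def max_def)
    then have "expectation f = expectation (\<lambda>_. 0)"
      by (intro Bochner_Integration.integral_cong) auto
    with Ef show False by simp
  qed
  then obtain \<omega>\<^sub>0 where \<omega>\<^sub>0: "\<omega>\<^sub>0 \<in> space M" "a \<bullet> U 0 \<omega>\<^sub>0 - b > 0"
    by (auto simp: Y_def X_def)
  define v where "v t = safe_velocity M G (U t)" for t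
  have deriv: "((\<lambda>s. U s \<omega>) has_vector_derivative
      (if a \<bullet> U t \<omega> - b \<ge> 0 then (a \<bullet> U t \<omega> - b) *\<^sub>R v t else 0)) (at t within {0..})"
    if "\<omega> \<in> space M" "t \<ge> 0" for \<omega> t
    using ode[OF that]
    unfolding safe_drift_eq[OF M meas[OF that(2)] sq[OF that(2)] assms(3) fd[OF that(2)]]
    unfolding v_def assms(3) by simp
  have v: "a \<bullet> v t \<le> 0" if "t \<ge> 0" for t
    unfolding v_def assms(3) by (rule safe_velocity_descends[OF M meas[OF that] sq[OF that]])
  obtain R where R0: "R 0 = 0"
    and dR: "\<And>t. t \<ge> 0 \<Longrightarrow> (R has_vector_derivative (1 + a \<bullet> R t) *\<^sub>R v t) (at t within {0..})"
    and q: "\<And>t. t \<ge> 0 \<Longrightarrow> 1 + a \<bullet> R t \<ge> 0"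
    and rep: "\<And>\<omega> t. \<omega> \<in> space M \<Longrightarrow> t \<ge> 0 \<Longrightarrow>
        U t \<omega> = U 0 \<omega> + max 0 (a \<bullet> U 0 \<omega> - b) *\<^sub>R R t"
    and pos: "\<And>\<omega> t. \<omega> \<in> space M \<Longrightarrow> t \<ge> 0 \<Longrightarrow>
        max 0 (a \<bullet> U t \<omega> - b) = (1 + a \<bullet> R t) * max 0 (a \<bullet> U 0 \<omega> - b)"
    by (rule particle_representation[where U = U and v = v and a = a and b = b, OF deriv v \<omega>\<^sub>0])
       (assumption | rule that; blast)+
  note transported = safe_velocity_transported[OF M intX meanX f_int f_sq fX, where G = G]
  have mean: "mean_vec M (U t) = expectation f *\<^sub>R R t" if "t \<ge> 0" for t
    by (rule transported(1)[where q = "1 + a \<bullet> R t"])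
       (use rep[OF _ that] pos[OF _ that] in \<open>auto simp: f_def Y_def X_def assms(3)\<close>)
  have v_eq: "v t = - (1 + a \<bullet> R t) *\<^sub>R ((variance f + B) *\<^sub>R a + variance f *\<^sub>R R t)"
    if "t \<ge> 0" for t
    unfolding v_def fX_axis[symmetric]
    by (rule transported(2))
       (use rep[OF _ that] pos[OF _ that] in \<open>auto simp: f_def Y_def X_def assms(3)\<close>)
  have "(R \<longlongrightarrow> - a) at_top"
  proof (rule displacement_limit)
    fix t :: real assume t: "t \<ge> 0"
    show "(R has_vector_derivative - (1 + a \<bullet> R t)\<^sup>2 *\<^sub>R
        ((variance f + B) *\<^sub>R a + variance f *\<^sub>R R t)) (at t within {0..})"
    proof -
      have square: "s *\<^sub>R (- s *\<^sub>R w) = - s\<^sup>2 *\<^sub>R w" for s and w :: "real ^ 'n"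
        by (simp add: power2_eq_square)
      show ?thesis using dR[OF t] unfolding v_eq[OF t] square .
    qed
  qed (use q R0 norm_a \<open>B > 0\<close> variance_positive in auto)
  then have "((\<lambda>t. expectation f *\<^sub>R R t) \<longlongrightarrow> expectation f *\<^sub>R (- a)) at_top"
    by (intro tendsto_intros)
  then have lim: "((\<lambda>t. mean_vec M (U t)) \<longlongrightarrow> expectation f *\<^sub>R (- a)) at_top"
    by (rule Lim_transform_eventually)
       (use mean in \<open>auto intro: eventually_at_top_linorderI[of 0]\<close>)

  \<comment> \<open>It remains to identify \<open>- expectation f\<close> with the two contributions in the claim.\<close>
  define e where "e = expectation (\<lambda>\<omega>. indicator F \<omega> * X \<omega> $ first)"
  have IF: "integrable M (indicat_real F)" by (simp add: less_top[symmetric])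
  have F_space: "F \<inter> space M = F" by (auto simp: F_def)
  have IX: "integrable M (\<lambda>\<omega>. indicator F \<omega> *\<^sub>R X \<omega>)"
    using intX by (intro integrable_mult_indicator) auto
  have Ixf: "integrable M (\<lambda>\<omega>. indicator F \<omega> * X \<omega> $ first)"
    using integrable_bounded_linear[OF bounded_linear_vec_nth IX, of first] by simp
  have ind: "indicator F \<omega> = indicat_real {..<b} (X \<omega> $ first)" if "\<omega> \<in> space M" for \<omega>
    using that by (simp add: F_eq indicator_def)
  have opt: "failure_prob M G X *\<^sub>R optimal_mean M G X = e *\<^sub>R a"
  proof -
    have "{\<omega> \<in> space M. G (X \<omega>) < 0} = F" by (simp add: F_def Y_def assms(3))
    then have "failure_prob M G X *\<^sub>R optimal_mean M G X = expectation (\<lambda>\<omega>. indicator F \<omega> *\<^sub>R X \<omega>)"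
      unfolding Pf optimal_mean_def using PF finite_measure_axioms
      by (simp add: uniform_measure_integral)
    also have "\<dots> = expectation (\<lambda>\<omega>. indicat_real {..<b} (X \<omega> $ first) *\<^sub>R X \<omega>)"
      by (rule Bochner_Integration.integral_cong) (auto simp: ind)
    also have "\<dots> = expectation (\<lambda>\<omega>. indicat_real {..<b} (X \<omega> $ first) * X \<omega> $ first) *\<^sub>R a"
      unfolding assms(2)
    proof (rule expectation_weighted_std_normal[OF M nX intX])
      show "integrable M (\<lambda>\<omega>. indicat_real {..<b} (X \<omega> $ first) *\<^sub>R X \<omega>)"
        using IX by (subst (asm) Bochner_Integration.integrable_cong[OF refl]) (auto simp: ind)
      show "integrable M (\<lambda>\<omega>. indicat_real {..<b} (X \<omega> $ first))"
        using IF by (subst Bochner_Integration.integrable_cong[OF refl, where g = "indicator F"])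
           (auto simp: ind)
    qed simp
    also have "expectation (\<lambda>\<omega>. indicat_real {..<b} (X \<omega> $ first) * X \<omega> $ first) = e"
      unfolding e_def by (rule Bochner_Integration.integral_cong) (auto simp: ind)
    finally show ?thesis .
  qed
  have "expectation f = expectation (\<lambda>\<omega>. Y \<omega> - (indicator F \<omega> * X \<omega> $ first - b * indicator F \<omega>))"
    by (rule Bochner_Integration.integral_cong)
       (auto simp: f_def F_def Y_def coord indicator_def max_def)
  also have "\<dots> = - b - (e - b * measure M F)"
    using intY Ixf IF F_space by (simp add: EY e_def)
  finally have "- expectation f = (1 - measure M F) * b + e" by (simp add: algebra_simps)
  then have "expectation f *\<^sub>R (- a) = ((1 - measure M F) * b + e) *\<^sub>R a"
    by (metis scaleR_minus_left scaleR_minus_right)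
  also have "\<dots> = (1 - measure M F) *\<^sub>R (b *\<^sub>R a) + e *\<^sub>R a"
    by (simp add: scaleR_add_left)
  also have "\<dots> = (1 - failure_prob M G (U 0)) *\<^sub>R most_likely_failure_point G
      + failure_prob M G (U 0) *\<^sub>R optimal_mean M G (U 0)"
    using opt Pf most_likely_failure_point_affine[OF norm_a, of b] by (simp add: X_def assms(3))
  finally show ?thesis using lim by simp
qed

end
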